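(* Let $\mathbb{S}$ be a (non-empty) finite collection of finite non-empty subsets of $\mathbb{R}$. Then the interval $[-\Delta_{\mathbb{S}}/2,\Delta_{\mathbb{S}}/2]$ is the minimal $G$-invariant set with respect to $\mathbb{S}$ that contains the origin. Hence, if $S_n\in\mathbb{S}$ and $x_n\in\operatorname{conv}S_n$ for all $n\ge0$, and $e_{n+1}=e_n+x_n-y_n$ where $y_n\in S_n$ is a closest point to $e_n+x_n$ in $S_n$ (the greedy algorithm), and if $e_0\in[-\Delta_{\mathbb{S}}/2,\Delta_{\mathbb{S}}/2]$, then the accumulated error satisfies $|e_n|\le\Delta_{\mathbb{S}}/2$ for all $n\ge1$.
   Context: For a finite non-empty $S\subset\mathbb{R}$ with elements $s_1<s_2<\dots<s_{|S|}$, the maximum stepsize is $\Delta_S:=0$ if $|S|=1$ and $\Delta_S:=\max_{1\le i\le|S|-1}(s_{i+1}-s_i)$ if $|S|>1$; for the collection, $\Delta_{\mathbb{S}}:=\max_{S\in\mathbb{S}}\Delta_S$. $\operatorname{conv}$ denotes convex hull. A closest point of $z$ in $S$ is any $c\in\arg\min_{\rho\in S}|\rho-z|$, and $\mathrm{Vor}_S$ denotes any map sending each $z$ to a closest point of $z$ in $S$. For $x\in\operatorname{conv}S$ let $G_{S,x}(e)=e+x-\mathrm{Vor}_S(e+x)$. A set $Q\subseteq\mathbb{R}$ is $G$-invariant with respect to $S$ if $G_{S,x}(Q)\subseteq Q$ for all $x\in\operatorname{conv}S$ (for every choice of $\mathrm{Vor}_S$), i.e. $e+x-c\in Q$ for all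 $e\in Q$, $x\in\operatorname{conv}S$ and all closest points $c$ of $e+x$ in $S$. $Q$ is $G$-invariant with respect to $\mathbb{S}$ if it is so with respect to every $S\in\mathbb{S}$. Minimal means: contained in every $G$-invariant set with respect to $\mathbb{S}$ that contains the origin. *)

theory Defs
  imports "HOL-Analysis.Analysis"
begin

definition stepsize :: "real set \<Rightarrow> real" where
  "stepsize S =
     (if card S = 1 then 0
      else Max {sorted_list_of_set S ! Suc i - sorted_list_of_set S ! i | i. Suc i < card S})"

definition max_stepsize :: "real set set \<Rightarrow> real" where
  "max_stepsize SS = Max (stepsize ` SS)"

definition is_closest_point :: "real set \<Rightarrow> real \<Rightarrow> real \<Rightarrow> bool" where
  "is_closest_point S z c \<longleftrightarrow> is_arg_min (\<lambda>r. \<bar>r - z\<bar>) (\<lambda>r. r \<in> S) c"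

text \<open>Closest points need not be unique, so a Voronoi map is any selection of closest points.\<close>

definition is_Vor :: "real set \<Rightarrow> (real \<Rightarrow> real) \<Rightarrow> bool" where
  "is_Vor S V \<longleftrightarrow> (\<forall>z. is_closest_point S z (V z))"

definition G_map :: "(real \<Rightarrow> real) \<Rightarrow> real \<Rightarrow> real \<Rightarrow> real" where
  "G_map V x e = e + x - V (e + x)"

definition G_invariant :: "real set \<Rightarrow> real set \<Rightarrow> bool" where
  "G_invariant S Q \<longleftrightarrow> (\<forall>V. is_Vor S V \<longrightarrow> (\<forall>x \<in> convex hull S. G_map V x ` Q \<subseteq> Q))"

definition G_invariant_coll :: "real set set \<Rightarrow> real set \<Rightarrow> bool" where
  "G_invariant_coll SS Q \<longleftrightarrow> (\<forall>S \<in> SS. G_invariant S Q)"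

text \<open>Minimality is the strong notion: the least invariant set containing the origin
  with respect to inclusion, not merely an inclusion-minimal one.\<close>

definition is_minimal_G_invariant :: "real set set \<Rightarrow> real set \<Rightarrow> bool" where
  "is_minimal_G_invariant SS Q \<longleftrightarrow>
     G_invariant_coll SS Q \<and> 0 \<in> Q \<and>
     (\<forall>Q'. G_invariant_coll SS Q' \<and> 0 \<in> Q' \<longrightarrow> Q \<subseteq> Q')"

end

theory Submission
  imports Defs
begin

text \<open>Invariance: a point of the convex hull of \<open>S\<close> shifted by at most \<open>d \<ge> \<Delta>\<^sub>S / 2\<close> either lies
  in a gap of \<open>S\<close>, hence within \<open>\<Delta>\<^sub>S / 2\<close> of an end of that gap, or overshoots an extreme
  point of \<open>S\<close> by at most \<open>d\<close>. Minimality: if \<open>a < b\<close> bound a gap of the largest length \<open>\<Delta>\<close>,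
  then a single step from the error \<open>0\<close> already reaches all of \<open>[-\<Delta>/2, \<Delta>/2]\<close>: inputs in the left
  half of \<open>[a, b]\<close>, rounded to \<open>a\<close>, give \<open>[0, \<Delta>/2]\<close>, those in the right half, rounded to \<open>b\<close>,
  give \<open>[-\<Delta>/2, 0]\<close>. The midpoint is a tie, so both of its roundings are allowed.\<close>

section \<open>Closest points and Voronoi maps\<close>

lemma is_closest_point_iff:
  "is_closest_point S z c \<longleftrightarrow> c \<in> S \<and> (\<forall>r\<in>S. \<bar>c - z\<bar> \<le> \<bar>r - z\<bar>)"
  by (auto simp: is_closest_point_def is_arg_min_linorder)

lemma ex_is_closest_point:
  assumes "finite S" "S \<noteq> {}"
  shows "\<exists>c. is_closest_point S z c"
  using ex_is_arg_min_if_finite[OF assms, of "\<lambda>r. \<bar>r - z\<bar>"]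
  by (auto simp: is_closest_point_def)

text \<open>Invariance quantifies over total Voronoi maps. Overriding an arbitrary selection at the
  single point \<open>z\<close> realises any desired resolution of a tie there.\<close>

lemma is_Vor_with_value:
  assumes "finite S" "S \<noteq> {}" "is_closest_point S z c"
  obtains V where "is_Vor S V" "V z = c"
proof -
  obtain W where "\<And>z. is_closest_point S z (W z)"
    using ex_is_closest_point[OF assms(1,2)] by metis
  then have "is_Vor S (W(z := c))"
    using assms(3) by (simp add: is_Vor_def)
  then show thesis
    by (rule that) simp
qed

section \<open>Gaps of a finite set and its stepsize\<close>

lemma finite_steps:
  "finite {sorted_list_of_set S ! Suc i - sorted_list_of_set S ! i | i. Suc i < card S}"
  (is "finite {?f i | i. _}")
proof -
  have "{?f i | i. Suc i < card S} \<subseteq> ?f ` {..<card S}"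
    by auto
  then show ?thesis
    by (rule finite_subset) simp
qed

text \<open>An index strictly between those of \<open>a\<close> and \<open>b\<close> would put an
  element of \<open>S\<close> into the gap, so the indices are consecutive.\<close>

lemma gap_le_stepsize:
  assumes "finite S" "a \<in> S" "b \<in> S" "a < b" and gap: "S \<inter> {a<..<b} = {}"
  shows "b - a \<le> stepsize S"
proof -
  let ?l = "sorted_list_of_set S"
  have set_l: "set ?l = S" and len: "length ?l = card S"
    using assms(1) by auto
  have strict: "?l ! i < ?l ! j" if "i < j" "j < card S" for i j
    using that strict_sorted_list_of_set[of S] len by (simp add: sorted_wrt_nth_less)
  obtain i where i: "i < card S" "?l ! i = a"
    using assms(2) set_l len by (metis in_set_conv_nth)
  obtain j where j: "j < card S" "?l ! j = b"
    using assms(3) set_l len by (metis in_set_conv_nth)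
  have "i < j"
    using strict[of j i] i j assms(4) by (cases i j rule: linorder_cases) auto
  have "j = Suc i"
  proof (rule ccontr)
    assume "j \<noteq> Suc i"
    with \<open>i < j\<close> have "Suc i < j"
      by simp
    then have "a < ?l ! Suc i" "?l ! Suc i < b"
      using strict[of i "Suc i"] strict[of "Suc i" j] i(2) j by simp_all
    moreover have "?l ! Suc i \<in> S"
      using \<open>Suc i < j\<close> j(1) set_l len by (metis nth_mem order.strict_trans)
    ultimately show False
      using gap by auto
  qed
  moreover have "card S \<noteq> 1"
    using assms(2-4) by (auto simp: card_1_singleton_iff)
  ultimately show ?thesis
    unfolding stepsize_def using i j by (auto intro!: Max_ge[OF finite_steps])
qed

text \<open>The maximum of the index steps is attained, and strict sorting leaves no element between
  consecutive entries. A nonzero stepsize excludes singletons.\<close>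

lemma stepsize_attained:
  assumes "finite S" "S \<noteq> {}" "stepsize S \<noteq> 0"
  obtains a b where "a \<in> S" "b \<in> S" "a < b" "S \<inter> {a<..<b} = {}" "stepsize S = b - a"
proof -
  let ?l = "sorted_list_of_set S"
  let ?M = "{?l ! Suc i - ?l ! i | i. Suc i < card S}"
  have set_l: "set ?l = S" and len: "length ?l = card S"
    using assms(1) by auto
  have strict: "?l ! i < ?l ! j" if "i < j" "j < card S" for i j
    using that strict_sorted_list_of_set[of S] len by (simp add: sorted_wrt_nth_less)
  have card: "card S \<noteq> 1"
    using assms(3) by (auto simp: stepsize_def)
  moreover have "card S \<noteq> 0"
    using assms by simp
  ultimately have "Suc 0 < card S"
    by linarith
  then have "?M \<noteq> {}"
    by blast
  then have "Max ?M \<in> ?M"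
    by (rule Max_in[OF finite_steps])
  then obtain i where i: "Suc i < card S" "stepsize S = ?l ! Suc i - ?l ! i"
    using card by (auto simp: stepsize_def)
  have "S \<inter> {?l ! i<..<?l ! Suc i} = {}"
  proof (rule ccontr)
    assume "S \<inter> {?l ! i<..<?l ! Suc i} \<noteq> {}"
    then obtain c where c: "c \<in> S" "?l ! i < c" "c < ?l ! Suc i"
      by auto
    then obtain j where j: "j < card S" "?l ! j = c"
      using set_l len by (metis in_set_conv_nth)
    have "i < j"
      using strict[of j i] i j c by (cases i j rule: linorder_cases) auto
    moreover have "j < Suc i"
      using strict[of "Suc i" j] i j c by (cases j "Suc i" rule: linorder_cases) auto
    ultimately show False
      by simp
  qed
  moreover have "?l ! i \<in> S" "?l ! Suc i \<in> S"
    using i set_l len by (metis Suc_lessD nth_mem, metis nth_mem)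
  ultimately show thesis
    using that strict[of i "Suc i"] i by blast
qed

lemma stepsize_nonneg:
  assumes "finite S" "S \<noteq> {}"
  shows "0 \<le> stepsize S"
proof (cases "stepsize S = 0")
  case False
  then show ?thesis
    using stepsize_attained[OF assms] by (metis diff_ge_0_iff_ge less_imp_le)
qed simp

section \<open>Error bound for one greedy step\<close>

lemma convex_hull_subset_Min_Max:
  fixes S :: "real set"
  assumes "finite S"
  shows "convex hull S \<subseteq> {Min S..Max S}"
  by (rule hull_minimal) (use assms in auto)

text \<open>The bound \<open>d\<close> is kept free of \<open>S\<close> so that one value can serve
  all sets of a collection.\<close>

lemma closest_point_error_le:
  assumes fin: "finite S" and ne: "S \<noteq> {}" and d: "stepsize S / 2 \<le> d"
    and e: "\<bar>e\<bar> \<le> d" and x: "x \<in> convex hull S" and c: "is_closest_point S (e + x) c"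
  shows "\<bar>e + x - c\<bar> \<le> d"
proof -
  let ?z = "e + x"
  have min: "\<bar>?z - c\<bar> \<le> \<bar>?z - r\<bar>" if "r \<in> S" for r
    using c that by (auto simp: is_closest_point_iff abs_minus_commute)
  have x': "Min S \<le> x" "x \<le> Max S"
    using convex_hull_subset_Min_Max[OF fin] x by auto
  have MM: "Min S \<in> S" "Max S \<in> S"
    using fin ne by auto
  consider "?z < Min S" | "?z > Max S" | "Min S \<le> ?z" "?z \<le> Max S"
    by linarith
  then show ?thesis
  proof cases
    \<comment> \<open>Since \<open>Min S\<close> \<le> \<open>x\<close>, the distance from
      \<open>?z\<close> to \<open>Min S\<close> is at most \<open>-e\<close>. Case 2 is the mirror
      image.\<close>
    case 1
    then show ?thesis
      using min[OF MM(1)] x' e by linarith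
  next
    case 2
    then show ?thesis
      using min[OF MM(2)] x' e by linarith
  next
    case 3
    \<comment> \<open>\<open>?a\<close> and \<open>?b\<close> are the neighbours of
      \<open>?z\<close> in \<open>S\<close>; they coincide exactly when \<open>?z\<close> lies in
      \<open>S\<close>.\<close>
    let ?A = "{s \<in> S. s \<le> ?z}" and ?B = "{s \<in> S. ?z \<le> s}"
    let ?a = "Max ?A" and ?b = "Min ?B"
    have "?A \<noteq> {}" "?B \<noteq> {}"
      using MM 3 by blast+
    then have "?a \<in> ?A" "?b \<in> ?B"
      using fin by (intro Max_in Min_in; simp)+
    then have ab: "?a \<in> S" "?a \<le> ?z" "?b \<in> S" "?z \<le> ?b"
      by auto
    have gap: "S \<inter> {?a<..<?b} = {}"
    proof (rule ccontr)
      assume "S \<inter> {?a<..<?b} \<noteq> {}"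
      then obtain s where s: "s \<in> S" "?a < s" "s < ?b"
        by auto
      show False
      proof (cases "s \<le> ?z")
        case True
        then have "s \<le> ?a"
          using fin s(1) by (intro Max_ge) auto
        with s show False
          by simp
      next
        case False
        then have "?b \<le> s"
          using fin s(1) by (intro Min_le) auto
        with s show False
          by simp
      qed
    qed
    have "?b - ?a \<le> stepsize S"
    proof (cases "?a < ?b")
      case True
      then show ?thesis
        using gap_le_stepsize[OF fin ab(1,3) _ gap] by simp
    next
      case False
      then show ?thesis
        using stepsize_nonneg[OF fin ne] by linarith
    qed
    \<comment> \<open>The distances from \<open>?z\<close> to \<open>?a\<close> and
      \<open>?b\<close> add up to \<open>?b - ?a\<close>, so the smaller one is at most half the
      stepsize.\<close>
    then show ?thesis
      using min[OF ab(1)] min[OF ab(3)] ab(2,4) d by linarith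
  qed
qed

section \<open>Invariant sets and minimality of the interval\<close>

lemma G_invariantD:
  assumes "G_invariant S Q" "finite S" "e \<in> Q" "x \<in> convex hull S"
    and c: "is_closest_point S (e + x) c"
  shows "e + x - c \<in> Q"
proof -
  have "S \<noteq> {}"
    using c by (auto simp: is_closest_point_iff)
  then obtain V where "is_Vor S V" "V (e + x) = c"
    using is_Vor_with_value[OF assms(2) _ c] by blast
  then show ?thesis
    using assms(1,3,4) by (auto simp: G_invariant_def G_map_def image_subset_iff)
qed

lemma G_invariant_interval:
  assumes "finite S" "S \<noteq> {}" "stepsize S / 2 \<le> d"
  shows "G_invariant S {-d..d}"
  unfolding G_invariant_def G_map_def
proof (intro allI impI ballI image_subsetI)
  fix V x e
  assume "is_Vor S V" "x \<in> convex hull S" "e \<in> {-d..d}"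
  then have "\<bar>e + x - V (e + x)\<bar> \<le> d"
    by (intro closest_point_error_le[OF assms]) (auto simp: is_Vor_def)
  then show "e + x - V (e + x) \<in> {-d..d}"
    by (auto simp: abs_le_iff)
qed

lemma interval_subset_G_invariant:
  assumes fin: "finite S" and ne: "S \<noteq> {}" and inv: "G_invariant S Q" and zero: "0 \<in> Q"
  shows "{- stepsize S / 2..stepsize S / 2} \<subseteq> Q"
proof (cases "stepsize S = 0")
  case True
  then show ?thesis
    using zero by auto
next
  case False
  then obtain a b where ab: "a \<in> S" "b \<in> S" "a < b" "S \<inter> {a<..<b} = {}" "stepsize S = b - a"
    using stepsize_attained[OF fin ne] by blast
  have outside: "r \<le> a \<or> b \<le> r" if "r \<in> S" for r
    using ab(4) that by force
  have hull: "x \<in> convex hull S" if "a \<le> x" "x \<le> b" for x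
  proof -
    have "convex hull {a, b} \<subseteq> convex hull S"
      using ab by (intro hull_mono) auto
    then show ?thesis
      using that by (auto simp: segment_convex_hull[symmetric] closed_segment_eq_real_ivl)
  qed
  show ?thesis
  proof
    fix q
    assume q: "q \<in> {- stepsize S / 2..stepsize S / 2}"
    \<comment> \<open>From error 0, the input \<open>q + c\<close> rounded to \<open>c\<close>
      leaves exactly the error \<open>q\<close>. The sign of \<open>q\<close> selects the end of the
      gap for which \<open>q + c\<close> stays in the half nearer to \<open>c\<close>.\<close>
    define c where "c = (if q \<ge> 0 then a else b)"
    have "is_closest_point S (q + c) c"
      unfolding is_closest_point_iff
    proof (intro conjI ballI)
      show "c \<in> S"
        using ab by (simp add: c_def)
      fix r
      assume "r \<in> S"
      then show "\<bar>c - (q + c)\<bar> \<le> \<bar>r - (q + c)\<bar>"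
        using outside[of r] q ab(3,5) by (auto simp: c_def)
    qed
    moreover have "q + c \<in> convex hull S"
      using q ab(3,5) by (intro hull) (auto simp: c_def)
    ultimately show "q \<in> Q"
      using G_invariantD[OF inv fin zero, of "q + c" c] by simp
  qed
qed

theorem theorem5:
  fixes SS :: "real set set"
  assumes "finite SS" and "SS \<noteq> {}"
    and "\<And>S. S \<in> SS \<Longrightarrow> finite S \<and> S \<noteq> {}"
  shows "is_minimal_G_invariant SS {- max_stepsize SS / 2 .. max_stepsize SS / 2} \<and>
    (\<forall>(S :: nat \<Rightarrow> real set) (x :: nat \<Rightarrow> real) (y :: nat \<Rightarrow> real) (e :: nat \<Rightarrow> real).
       (\<forall>n. S n \<in> SS \<and> x n \<in> convex hull (S n) \<and>
            is_closest_point (S n) (e n + x n) (y n) \<and>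
            e (Suc n) = e n + x n - y n) \<and>
       e 0 \<in> {- max_stepsize SS / 2 .. max_stepsize SS / 2} \<longrightarrow>
       (\<forall>n\<ge>1. \<bar>e n\<bar> \<le> max_stepsize SS / 2))"
proof -
  let ?d = "max_stepsize SS / 2"
  have le: "stepsize S / 2 \<le> ?d" if "S \<in> SS" for S
    using assms(1) that by (auto simp: max_stepsize_def intro!: Max_ge)
  \<comment> \<open>A single set \<open>T\<close> of largest stepsize already forces the whole
    interval.\<close>
  have "max_stepsize SS \<in> stepsize ` SS"
    unfolding max_stepsize_def using assms(1,2) by (intro Max_in) auto
  then obtain T where T: "T \<in> SS" "stepsize T = max_stepsize SS"
    by auto
  have inv: "G_invariant_coll SS {-?d..?d}"
    using assms(3) le by (auto simp: G_invariant_coll_def intro!: G_invariant_interval)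
  have "is_minimal_G_invariant SS {-?d..?d}"
    unfolding is_minimal_G_invariant_def
  proof (intro conjI allI impI)
    show "0 \<in> {-?d..?d}"
      using stepsize_nonneg[of T] assms(3)[OF T(1)] T(2) by auto
    fix Q
    assume "G_invariant_coll SS Q \<and> 0 \<in> Q"
    then show "{-?d..?d} \<subseteq> Q"
      using interval_subset_G_invariant[of T Q] assms(3)[OF T(1)] T
      by (auto simp: G_invariant_coll_def)
  qed (rule inv)
  moreover have "\<bar>e n\<bar> \<le> ?d"
    if step: "\<forall>n. S n \<in> SS \<and> x n \<in> convex hull (S n) \<and>
            is_closest_point (S n) (e n + x n) (y n) \<and> e (Suc n) = e n + x n - y n"
      and e0: "e 0 \<in> {-?d..?d}"
    for S :: "nat \<Rightarrow> real set" and x y e :: "nat \<Rightarrow> real" and n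
  \<comment> \<open>The one-step bound with the common \<open>?d\<close> carries over even though
    \<open>S n\<close> changes with \<open>n\<close>.\<close>
  proof (induction n)
    case 0
    then show ?case
      using e0 by auto
  next
    case (Suc n)
    then show ?case
      using closest_point_error_le[of "S n" ?d "e n" "x n" "y n"] step assms(3) le by simp
  qed
  ultimately show ?thesis
    \<comment> \<open>The stated left endpoint parses as \<open>(- max_stepsize SS) / 2\<close>,
      whereas \<open>-?d\<close> negates the quotient.\<close>
    unfolding minus_divide_left[symmetric] by blast
qed

end
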